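(* (a) Let $\langle K,R,\vDash\rangle$ be a Kripke model such that for every $k\in K$: the restriction of $R$ to $R^+[k]$ is transitive (for all $x,y,z\in R^+[k]$, $xRy$ and $yRz$ imply $xRz$), and $\vDash$ restricted to $R^{++}[k]$ is formula persistent (for all $x,y\in R^{++}[k]$ with $xRy$ and every formula $\chi$, $x\vDash\chi$ implies $y\vDash\chi$). Then for all formulas $\varphi,\psi,\theta$, the formula $[(\varphi\&\psi)\rightarrow\theta]\rightarrow[\varphi\rightarrow(\psi\rightarrow\theta)]$ holds at every node of this model. (b) Conversely, suppose the axiom scheme $[(\varphi\&\psi)\rightarrow\theta]\rightarrow[\varphi\rightarrow(\psi\rightarrow\theta)]$ is satisfied in a Kripke frame $\langle K,R\rangle$ (every instance holds at every node of every Kripke model on the frame). Then for every $k\in K$ the restriction of $R$ to $R^+[k]$ is transitive; and every Kripke model on this frame in which that scheme holds at every node has a satisfaction relation whose restriction to $R^{++}[k]$ is formula persistent for every $k\in K$.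
   Context: Formulas are built from a countably infinite set of atoms and the constant $\bot$ (falsity) using the binary connectives $\&$ and $\rightarrow$. A Kripke frame is a pair $\langle K,R\rangle$ with $R\subseteq K\times K$ an arbitrary binary relation; a Kripke model on it is $\langle K,R,\vDash\rangle$ with $\vDash\subseteq K\times\mathsf{Atoms}$ arbitrary, extended to formulas by: $k\nvDash\bot$; $k\vDash\varphi\&\psi$ iff $k\vDash\varphi$ and $k\vDash\psi$; $k\vDash\varphi\rightarrow\psi$ iff for every $k'$ with $kRk'$, if $k'\vDash\varphi$ then $k'\vDash\psi$. For $k\in K$, $R^n[k]=\{x\mid \exists y_1,\dots,y_{n-1}\,(kRy_1R\cdots Ry_{n-1}Rx)\}$, $R^+[k]=\bigcup_{n\ge1}R^n[k]$ and $R^{++}[k]=\bigcup_{n\ge2}R^n[k]$. *)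

theory Defs imports Main begin

type_synonym atom = nat

datatype form =
    Atom atom
  | Falsum ("\<^bold>\<bottom>")
  | Conj form form (infixr "\<^bold>&" 65)
  | Imp form form (infixr "\<^bold>\<rightarrow>" 60)

definition kripke_frame :: "'w set \<Rightarrow> ('w \<times> 'w) set \<Rightarrow> bool" where
  "kripke_frame K R \<longleftrightarrow> R \<subseteq> K \<times> K"

definition kripke_model :: "'w set \<Rightarrow> ('w \<times> 'w) set \<Rightarrow> ('w \<times> atom) set \<Rightarrow> bool" where
  "kripke_model K R V \<longleftrightarrow> kripke_frame K R \<and> V \<subseteq> K \<times> UNIV"

text \<open>In the clause for implication the quantifier need not be relativised to the carrier,
  since the accessibility relation of a frame is contained in \<open>K \<times> K\<close>.\<close>

fun sat :: "('w \<times> 'w) set \<Rightarrow> ('w \<times> atom) set \<Rightarrow> 'w \<Rightarrow> form \<Rightarrow> bool" where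
  "sat R V k (Atom p) \<longleftrightarrow> (k, p) \<in> V"
| "sat R V k \<^bold>\<bottom> \<longleftrightarrow> False"
| "sat R V k (\<phi> \<^bold>& \<psi>) \<longleftrightarrow> sat R V k \<phi> \<and> sat R V k \<psi>"
| "sat R V k (\<phi> \<^bold>\<rightarrow> \<psi>) \<longleftrightarrow> (\<forall>k'. (k, k') \<in> R \<longrightarrow> sat R V k' \<phi> \<longrightarrow> sat R V k' \<psi>)"

definition R_plus :: "('w \<times> 'w) set \<Rightarrow> 'w \<Rightarrow> 'w set" where
  "R_plus R k = (\<Union>n\<in>{1..}. (R ^^ n) `` {k})"

definition R_plusplus :: "('w \<times> 'w) set \<Rightarrow> 'w \<Rightarrow> 'w set" where
  "R_plusplus R k = (\<Union>n\<in>{2..}. (R ^^ n) `` {k})"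

definition formula_persistent_on ::
    "'w set \<Rightarrow> ('w \<times> 'w) set \<Rightarrow> ('w \<times> atom) set \<Rightarrow> bool" where
  "formula_persistent_on A R V \<longleftrightarrow>
     (\<forall>x\<in>A. \<forall>y\<in>A. (x, y) \<in> R \<longrightarrow> (\<forall>\<chi>. sat R V x \<chi> \<longrightarrow> sat R V y \<chi>))"

definition exportation :: "form \<Rightarrow> form \<Rightarrow> form \<Rightarrow> form" where
  "exportation \<phi> \<psi> \<theta> = ((\<phi> \<^bold>& \<psi>) \<^bold>\<rightarrow> \<theta>) \<^bold>\<rightarrow> (\<phi> \<^bold>\<rightarrow> (\<psi> \<^bold>\<rightarrow> \<theta>))"

definition scheme_holds_in_model ::
    "'w set \<Rightarrow> ('w \<times> 'w) set \<Rightarrow> ('w \<times> atom) set \<Rightarrow> bool" where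
  "scheme_holds_in_model K R V \<longleftrightarrow> (\<forall>\<phi> \<psi> \<theta>. \<forall>k\<in>K. sat R V k (exportation \<phi> \<psi> \<theta>))"

definition scheme_satisfied_in_frame :: "'w set \<Rightarrow> ('w \<times> 'w) set \<Rightarrow> bool" where
  "scheme_satisfied_in_frame K R \<longleftrightarrow>
     (\<forall>V. kripke_model K R V \<longrightarrow> scheme_holds_in_model K R V)"

end

theory Submission imports Defs begin

text \<open>Evaluated at a node \<open>w\<close>, exportation concerns chains \<open>w\<close>,
  \<open>x\<close>, \<open>y\<close>, \<open>z\<close> of successive \<open>R\<close>-steps: the
  premise is assumed at \<open>x\<close>, \<phi> at \<open>y\<close> and \<psi> at \<open>z\<close>,
  and \<theta> is wanted at \<open>z\<close>. It follows if \<open>x\<close> sees \<open>z\<close>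
  and \<phi> persists from \<open>y\<close> to \<open>z\<close>; these nodes lie one, two and three
  steps above \<open>w\<close>, whence \<open>R_plus\<close> for transitivity and
  \<open>R_plusplus\<close> for persistence (\<open>sat_exportation\<close>). Conversely, a node of
  \<open>R_plus\<close> has a predecessor at which to evaluate the scheme, and a missing edge from
  \<open>x\<close> to \<open>z\<close> yields a countermodel. Persistence comes from one well-chosen
  instance.\<close>

lemma R_plus_iff: "x \<in> R_plus R k \<longleftrightarrow> (\<exists>w. (k, w) \<in> R\<^sup>* \<and> (w, x) \<in> R)"
proof
  assume "x \<in> R_plus R k"
  then obtain n where "1 \<le> n" "(k, x) \<in> R ^^ n"
    by (auto simp: R_plus_def)
  then obtain m where "(k, x) \<in> R ^^ Suc m"
    by (cases n) auto
  then show "\<exists>w. (k, w) \<in> R\<^sup>* \<and> (w, x) \<in> R"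
    by (auto intro: relpow_imp_rtrancl)
next
  assume "\<exists>w. (k, w) \<in> R\<^sup>* \<and> (w, x) \<in> R"
  then obtain w m where "(k, w) \<in> R ^^ m" "(w, x) \<in> R"
    by (auto simp: rtrancl_power)
  then have "(k, x) \<in> R ^^ Suc m"
    by auto
  then show "x \<in> R_plus R k"
    unfolding R_plus_def by (intro UN_I[of "Suc m"]) auto
qed

lemma R_plusplus_iff:
  "x \<in> R_plusplus R k \<longleftrightarrow> (\<exists>v w. (k, v) \<in> R\<^sup>* \<and> (v, w) \<in> R \<and> (w, x) \<in> R)"
proof
  assume "x \<in> R_plusplus R k"
  then obtain n where "2 \<le> n" "(k, x) \<in> R ^^ n"
    by (auto simp: R_plusplus_def)
  then obtain m where "(k, x) \<in> R ^^ Suc (Suc m)"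
    by (metis Suc_le_D numeral_2_eq_2 Suc_le_mono)
  then show "\<exists>v w. (k, v) \<in> R\<^sup>* \<and> (v, w) \<in> R \<and> (w, x) \<in> R"
    by (auto intro: relpow_imp_rtrancl)
next
  assume "\<exists>v w. (k, v) \<in> R\<^sup>* \<and> (v, w) \<in> R \<and> (w, x) \<in> R"
  then obtain v w m where "(k, v) \<in> R ^^ m" "(v, w) \<in> R" "(w, x) \<in> R"
    by (auto simp: rtrancl_power)
  then have "(k, x) \<in> R ^^ Suc (Suc m)"
    by auto
  then show "x \<in> R_plusplus R k"
    unfolding R_plusplus_def by (intro UN_I[of "Suc (Suc m)"]) auto
qed

text \<open>Reads exportation along a single chain; both converse arguments only choose the instance
  and the chain.\<close>

lemma sat_exportationD:
  assumes "sat R V w (exportation \<phi> \<psi> \<theta>)"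
    and "(w, x) \<in> R" "(x, y) \<in> R" "(y, z) \<in> R"
    and "sat R V x ((\<phi> \<^bold>& \<psi>) \<^bold>\<rightarrow> \<theta>)" "sat R V y \<phi>" "sat R V z \<psi>"
  shows "sat R V z \<theta>"
proof -
  \<comment> \<open>Only the implication at \<open>w\<close> is unfolded, so that the premise at
    \<open>x\<close> stays literally the assumed formula.\<close>
  have "sat R V x (\<phi> \<^bold>\<rightarrow> (\<psi> \<^bold>\<rightarrow> \<theta>))"
    using assms(1,2,5) unfolding exportation_def sat.simps(4)[of R V w] by blast
  then show ?thesis
    using assms(3,4,6,7) by simp
qed

lemma sat_exportation:
  assumes trans: "trans_on (R_plus R k) R"
    and pers: "formula_persistent_on (R_plusplus R k) R V"
  shows "sat R V k (exportation \<phi> \<psi> \<theta>)"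
proof -
  have "sat R V z \<theta>"
    if R: "(k, x) \<in> R" "(x, y) \<in> R" "(y, z) \<in> R"
      and sat: "sat R V x ((\<phi> \<^bold>& \<psi>) \<^bold>\<rightarrow> \<theta>)" "sat R V y \<phi>" "sat R V z \<psi>" for x y z
  proof -
    have "x \<in> R_plus R k" "y \<in> R_plus R k" "z \<in> R_plus R k"
      using R by (auto simp: R_plus_iff intro: rtrancl.intros)
    then have xz: "(x, z) \<in> R"
      using trans R by (blast dest: trans_onD)
    have "y \<in> R_plusplus R k" "z \<in> R_plusplus R k"
      using R by (auto simp: R_plusplus_iff intro: rtrancl.intros)
    \<comment> \<open>The premise at \<open>x\<close> needs the whole conjunction at
      \<open>z\<close>, where so far only \<psi> is known.\<close>
    then have "sat R V z \<phi>"
      using pers R(3) sat(2) unfolding formula_persistent_on_def by blast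
    then show ?thesis
      using sat xz by simp
  qed
  then show ?thesis
    unfolding exportation_def by simp
qed

lemma kripke_frame_in_carrier:
  "kripke_frame K R \<Longrightarrow> (x, y) \<in> R \<Longrightarrow> x \<in> K \<and> y \<in> K"
  by (auto simp: kripke_frame_def)

lemma scheme_satisfied_imp_trans_on:
  assumes frame: "kripke_frame K R" and scheme: "scheme_satisfied_in_frame K R"
  shows "trans_on (R_plus R k) R"
proof (rule trans_onI)
  fix x y z
  assume "x \<in> R_plus R k" and xy: "(x, y) \<in> R" and yz: "(y, z) \<in> R"
  then obtain w where wx: "(w, x) \<in> R"
    by (auto simp: R_plus_iff)
  show "(x, z) \<in> R"
  proof (rule ccontr)
    assume xz: "(x, z) \<notin> R"
    \<comment> \<open>The first atom holds at \<open>y\<close> and \<open>z\<close>, the second only at \<open>z\<close>, so that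
      their conjunction is refutable at \<open>x\<close> but not its exported form.\<close>
    define V :: "('a \<times> atom) set" where "V = {(y, 0), (z, 0), (z, 1)}"
    have "kripke_model K R V"
      using frame kripke_frame_in_carrier[OF frame yz] by (auto simp: kripke_model_def V_def)
    then have "sat R V w (exportation (Atom 0) (Atom 1) \<^bold>\<bottom>)"
      using scheme kripke_frame_in_carrier[OF frame wx]
      by (auto simp: scheme_satisfied_in_frame_def scheme_holds_in_model_def)
    moreover have "sat R V x ((Atom 0 \<^bold>& Atom 1) \<^bold>\<rightarrow> \<^bold>\<bottom>)"
      using xz by (auto simp: V_def)
    ultimately have "sat R V z \<^bold>\<bottom>"
      by (rule sat_exportationD[OF _ wx xy yz]) (simp_all add: V_def)
    then show False
      by simp
  qed
qed

text \<open>Taking a tautology for \<psi> and \<chi> for both \<phi> and \<theta> makes the premise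
  hold everywhere, while the exported implication carries \<chi> from a node to its successors. Two
  predecessors of \<open>x\<close> are used: \<open>w\<close>, where that implication holds, and
  \<open>v\<close>, where the scheme is evaluated.\<close>

lemma scheme_holds_imp_formula_persistent_on:
  assumes frame: "kripke_frame K R" and scheme: "scheme_holds_in_model K R V"
  shows "formula_persistent_on (R_plusplus R k) R V"
  unfolding formula_persistent_on_def
proof (intro ballI impI allI)
  fix x y \<chi>
  assume "x \<in> R_plusplus R k" and xy: "(x, y) \<in> R" and sat: "sat R V x \<chi>"
  then obtain v w where vw: "(v, w) \<in> R" and wx: "(w, x) \<in> R"
    by (auto simp: R_plusplus_iff)
  have "sat R V v (exportation \<chi> (\<^bold>\<bottom> \<^bold>\<rightarrow> \<^bold>\<bottom>) \<chi>)"
    using scheme kripke_frame_in_carrier[OF frame vw] by (simp add: scheme_holds_in_model_def)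
  then show "sat R V y \<chi>"
    using vw wx xy by (rule sat_exportationD) (simp_all add: sat)
qed

theorem theorem5:
  fixes K :: "'w set" and R :: "('w \<times> 'w) set"
  assumes "kripke_frame K R"
  shows "(\<forall>V. kripke_model K R V
            \<longrightarrow> (\<forall>k\<in>K. trans_on (R_plus R k) R \<and> formula_persistent_on (R_plusplus R k) R V)
            \<longrightarrow> (\<forall>\<phi> \<psi> \<theta>. \<forall>k\<in>K. sat R V k (exportation \<phi> \<psi> \<theta>)))
       \<and> (scheme_satisfied_in_frame K R
            \<longrightarrow> (\<forall>k\<in>K. trans_on (R_plus R k) R)
              \<and> (\<forall>V. kripke_model K R V \<longrightarrow> scheme_holds_in_model K R V
                     \<longrightarrow> (\<forall>k\<in>K. formula_persistent_on (R_plusplus R k) R V)))"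
  using assms
  by (blast intro: sat_exportation scheme_satisfied_imp_trans_on
      scheme_holds_imp_formula_persistent_on)

end
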